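(* Let $n \ge 1$. Let $\mathcal{X}_n \subset \mathbb{R}^n$ be the set of all mean score sequences $(x_1,\ldots,x_n)$ of random $n$-team tournaments, and let $\mathcal{X}_n^{B-T} \subset \mathcal{X}_n$ be the set of mean score sequences arising from the Bradley--Terry model, i.e. $$\mathcal{X}_n^{B-T} = \Big\{ \Big(\sum_{j \ne i} L(\lambda_i - \lambda_j)\Big)_{1 \le i \le n} : (\lambda_1,\ldots,\lambda_n) \in \mathbb{R}^n \Big\}, \qquad L(u) = \frac{e^u}{1+e^u}.$$ Then the closure of $\mathcal{X}_n^{B-T}$ in $\mathbb{R}^n$ is $\mathcal{X}_n$.
   Context: An $n$-team tournament is a specification, for each unordered pair $\{i,j\}$ of distinct elements of $\{1,\ldots,n\}$, of which of the two teams $i,j$ beats the other (each pair plays exactly once, with no ties); there are $2^{\binom{n}{2}}$ tournaments. A random tournament is given by an arbitrary probability distribution $\mu$ on the set of all $n$-team tournaments (match results need not be independent). Its mean score sequence is $(x_1,\ldots,x_n)$, where $x_i$ is the expected number of wins of team $i$ under $\mu$. The Bradley--Terry model with real parameters $(\lambda_i, 1 \le i \le n)$ is the random tournament in which match results are independent and $\Pr(i \text{ beats } j) = L(\lambda_i - \lambda_j)$ for $i \neq j$, where $L(u) = e^u/(1+e^u)$, $u\in\mathbb{R}$, is the logistic function. *)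

theory Defs
  imports "HOL-Probability.Probability"
begin

text \<open>
  Teams are the elements of a finite type \<open>'n\<close>, so that \<open>n = CARD('n) \<ge> 1\<close> and
  \<open>real ^ 'n\<close> plays the role of the n-dimensional real space. A tournament is a relation \<open>T\<close>
  in which \<open>(i, j) \<in> T\<close> means that \<open>i\<close> beats \<open>j\<close>.
\<close>

definition tournament :: "('n \<times> 'n) set \<Rightarrow> bool" where
  "tournament T \<longleftrightarrow> asym T \<and> total T"

definition random_tournament :: "('n :: finite \<times> 'n) set pmf \<Rightarrow> bool" where
  "random_tournament \<mu> \<longleftrightarrow> (\<forall>T \<in> set_pmf \<mu>. tournament T)"

definition wins :: "('n :: finite \<times> 'n) set \<Rightarrow> 'n \<Rightarrow> nat" where
  "wins T i = card {j. (i, j) \<in> T}"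

definition mean_score :: "('n :: finite \<times> 'n) set pmf \<Rightarrow> real ^ 'n" where
  "mean_score \<mu> = (\<chi> i. measure_pmf.expectation \<mu> (\<lambda>T. real (wins T i)))"

definition mean_scores :: "(real ^ 'n :: finite) set" where
  "mean_scores = {mean_score \<mu> | \<mu>. random_tournament \<mu>}"

definition logistic :: "real \<Rightarrow> real" where
  "logistic u = exp u / (1 + exp u)"

text \<open>
  There is one match per two-element set \<open>P\<close> of teams; its result is the part \<open>T \<inter> P \<times> P\<close>
  of the tournament.
\<close>

definition independent_matches :: "('n :: finite \<times> 'n) set pmf \<Rightarrow> bool" where
  "independent_matches \<mu> \<longleftrightarrow>
     prob_space.indep_vars (measure_pmf \<mu>) (\<lambda>_. count_space UNIV)
       (\<lambda>P T. T \<inter> P \<times> P) {P. card P = 2}"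

definition bradley_terry :: "real ^ 'n \<Rightarrow> ('n :: finite \<times> 'n) set pmf \<Rightarrow> bool" where
  "bradley_terry r \<mu> \<longleftrightarrow>
     random_tournament \<mu> \<and> independent_matches \<mu> \<and>
     (\<forall>i j. i \<noteq> j \<longrightarrow>
        measure_pmf.prob \<mu> {T. (i, j) \<in> T} = logistic (r $ i - r $ j))"

definition bradley_terry_mean_scores :: "(real ^ 'n :: finite) set" where
  "bradley_terry_mean_scores = {mean_score \<mu> | r \<mu>. bradley_terry r \<mu>}"

lemma bradley_terry_mean_scores_subset: "bradley_terry_mean_scores \<subseteq> mean_scores"
  by (auto simp: bradley_terry_mean_scores_def mean_scores_def bradley_terry_def)

lemma logistic_nonneg: "0 \<le> logistic u"
  and logistic_le_1: "logistic u \<le> 1"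
  by (simp_all add: logistic_def field_simps add_pos_pos)

lemma logistic_minus: "logistic (- u) = 1 - logistic u"
proof -
  have "1 + exp u \<noteq> 0" "1 + exp (- u) \<noteq> 0"
    using exp_gt_zero[of u] exp_gt_zero[of "- u"] by linarith+
  then show ?thesis
    by (simp add: logistic_def field_simps flip: exp_add)
qed

lemma mean_score_nth:
  assumes "random_tournament \<mu>"
  shows "mean_score \<mu> $ i = (\<Sum>j\<in>UNIV - {i}. measure_pmf.prob \<mu> {T. (i, j) \<in> T})"
proof -
  have w: "real (wins T i) = (\<Sum>j\<in>UNIV. indicator {T. (i, j) \<in> T} T)" for T
    by (simp add: wins_def indicator_def sum.If_cases)
  have "mean_score \<mu> $ i = (\<Sum>j\<in>UNIV. measure_pmf.prob \<mu> {T. (i, j) \<in> T})"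
    by (simp add: mean_score_def w del: indicator_simps)
       (subst Bochner_Integration.integral_sum,
         auto intro: measure_pmf.integrable_const_bound[where B = 1])
  also have "\<dots> = (\<Sum>j\<in>UNIV - {i}. measure_pmf.prob \<mu> {T. (i, j) \<in> T})"
  proof (rule sum.mono_neutral_right)
    have "measure_pmf.prob \<mu> {T. (i, i) \<in> T} = 0"
      using assms by (auto simp: random_tournament_def tournament_def measure_pmf_zero_iff dest: asymD)
    then show "\<forall>j\<in>UNIV - (UNIV - {i}). measure_pmf.prob \<mu> {T. (i, j) \<in> T} = 0"
      by auto
  qed auto
  finally show ?thesis .
qed

lemma indep_vars_map_pmf:
  assumes "prob_space.indep_vars (measure_pmf p) (\<lambda>_. count_space UNIV) (\<lambda>i x. X i (F x)) I"
  shows "prob_space.indep_vars (measure_pmf (map_pmf F p)) (\<lambda>_. count_space UNIV) X I"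
proof -
  have *: "measure_pmf.prob (map_pmf F p) (\<Inter>j\<in>J. A j) = (\<Prod>j\<in>J. measure_pmf.prob (map_pmf F p) (A j))"
    if J: "J \<subseteq> I" "J \<noteq> {}" "finite J" and A: "\<forall>j\<in>J. \<exists>B. A j = X j -` B" for J A
  proof -
    have "F -` A j \<in> {(\<lambda>x. X j (F x)) -` B | B. True}" if "j \<in> J" for j
      using A that by (fastforce simp: vimage_def)
    then have "measure_pmf.prob p (\<Inter>j\<in>J. F -` A j) = (\<Prod>j\<in>J. measure_pmf.prob p (F -` A j))"
      using assms J by (simp add: prob_space.indep_vars_def2[OF prob_space_measure_pmf]
          prob_space.indep_sets_def[OF prob_space_measure_pmf])
    moreover have "F -` (\<Inter>j\<in>J. A j) = (\<Inter>j\<in>J. F -` A j)"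
      by auto
    ultimately show ?thesis
      by simp
  qed
  show ?thesis
    unfolding prob_space.indep_vars_def2[OF prob_space_measure_pmf]
      prob_space.indep_sets_def[OF prob_space_measure_pmf]
  proof (intro conjI allI impI ballI)
    fix J A assume J: "J \<subseteq> I" "J \<noteq> {}" "finite J"
      and A: "A \<in> (\<Pi> i\<in>J. {X i -` B \<inter> space (map_pmf F p) | B. B \<in> sets (count_space UNIV)})"
    have "\<forall>j\<in>J. \<exists>B. A j = X j -` B"
      using A by (auto simp: Pi_iff)
    then show "measure_pmf.prob (map_pmf F p) (\<Inter>j\<in>J. A j) = (\<Prod>j\<in>J. measure_pmf.prob (map_pmf F p) (A j))"
      by (rule *[OF J])
  qed simp_all
qed

lemma bradley_terry_exists: "\<exists>\<mu>. bradley_terry r \<mu>"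
proof -
  define I where "I = {P :: 'a set. card P = 2}"
  have "\<forall>P\<in>I. \<exists>e. P = {fst e, snd e} \<and> fst e \<noteq> snd e"
    by (auto simp: I_def card_2_iff)
  then obtain e where e: "\<And>P. P \<in> I \<Longrightarrow> P = {fst (e P), snd (e P)} \<and> fst (e P) \<noteq> snd (e P)"
    by metis
  define M where "M P = map_pmf (\<lambda>w. if w then e P else prod.swap (e P))
      (bernoulli_pmf (logistic (r $ fst (e P) - r $ snd (e P))))" for P
  define G where "G P x = {x} \<inter> (P \<times> P - Id)" for P and x :: "'a \<times> 'a"
  define F where "F f = (\<Union>P\<in>I. G P (f P))" for f :: "'a set \<Rightarrow> 'a \<times> 'a"
  define p where "p = Pi_pmf I undefined M"
  define \<mu> where "\<mu> = map_pmf F p"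
  have FP: "F f \<inter> P \<times> P = G P (f P)" if "P \<in> I" for f P
  proof -
    have eq: "Q = P" if "Q \<in> I" "(x, y) \<in> Q \<times> Q" "(x, y) \<in> P \<times> P" "x \<noteq> y" for Q x y
    proof -
      have "P = {x, y}" "Q = {x, y}"
        using that \<open>P \<in> I\<close> by (auto simp: I_def card_2_iff)
      then show ?thesis
        by simp
    qed
    have "G Q (f Q) \<inter> P \<times> P \<subseteq> G P (f P)" if Q: "Q \<in> I" for Q
    proof
      fix z assume z: "z \<in> G Q (f Q) \<inter> P \<times> P"
      then have "Q = P"
        using eq[OF Q, of "fst z" "snd z"] by (auto simp: G_def)
      with z show "z \<in> G P (f P)"
        by simp
    qed
    moreover have "G P (f P) \<subseteq> P \<times> P"
      by (auto simp: G_def)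
    ultimately show ?thesis
      using that unfolding F_def by blast
  qed
  have mem: "(i, j) \<in> F f \<longleftrightarrow> f {i, j} = (i, j)" if "i \<noteq> j" for f i j
  proof -
    have I: "{i, j} \<in> I"
      using that by (auto simp: I_def)
    have "(i, j) \<in> F f \<longleftrightarrow> (i, j) \<in> F f \<inter> {i, j} \<times> {i, j}"
      by auto
    also have "\<dots> \<longleftrightarrow> f {i, j} = (i, j)"
      unfolding FP[OF I] using that by (auto simp: G_def)
    finally show ?thesis .
  qed
  have orient: "e {i, j} = (i, j) \<or> e {i, j} = (j, i)" if "i \<noteq> j" for i j
  proof -
    have "{i, j} \<in> I"
      using that by (auto simp: I_def)
    from e[OF this] show ?thesis
      by (cases "e {i, j}") (auto simp: doubleton_eq_iff)
  qed
  have "random_tournament \<mu>"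
    unfolding random_tournament_def tournament_def
  proof (intro ballI conjI)
    fix T assume "T \<in> set_pmf \<mu>"
    then obtain f where f: "f \<in> set_pmf p" and T: "T = F f"
      by (auto simp: \<mu>_def)
    have irr: "(i, i) \<notin> F f" for i
      by (auto simp: F_def G_def)
    show "asym T"
      unfolding T by (rule asymI) (metis irr mem insert_commute prod.inject)
    have fe: "f P = e P \<or> f P = prod.swap (e P)" if "P \<in> I" for P
    proof -
      have "f P \<in> set_pmf (M P)"
        using f that by (auto simp: p_def set_Pi_pmf PiE_dflt_def)
      then show ?thesis
        by (auto simp: M_def split: if_splits)
    qed
    have "f {i, j} = (i, j) \<or> f {i, j} = (j, i)" if "i \<noteq> j" for i j
      using that orient[OF that] fe[of "{i, j}"] by (auto simp: I_def)
    then show "total T"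
      unfolding T total_on_def by (metis mem insert_commute)
  qed
  moreover have "independent_matches \<mu>"
  proof -
    have "prob_space.indep_vars (measure_pmf p) (\<lambda>_. count_space UNIV) (\<lambda>P f. G P (f P)) I"
      unfolding p_def by (rule prob_space.indep_vars_compose2[OF prob_space_measure_pmf indep_vars_Pi_pmf]) auto
    then have "prob_space.indep_vars (measure_pmf p) (\<lambda>_. count_space UNIV) (\<lambda>P f. F f \<inter> P \<times> P) I"
      by (subst prob_space.indep_vars_cong[OF prob_space_measure_pmf refl _ refl, where Y = "\<lambda>P f. G P (f P)"])
         (auto simp: FP fun_eq_iff)
    then show ?thesis
      unfolding independent_matches_def \<mu>_def I_def[symmetric] by (rule indep_vars_map_pmf)
  qed
  moreover have "measure_pmf.prob \<mu> {T. (i, j) \<in> T} = logistic (r $ i - r $ j)"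
    if "i \<noteq> j" for i j
  proof -
    have I: "{i, j} \<in> I"
      using that by (auto simp: I_def)
    have "measure_pmf.prob \<mu> {T. (i, j) \<in> T} = measure_pmf.prob p ((\<lambda>f. f {i, j}) -` {(i, j)})"
      using mem[OF that] by (simp add: \<mu>_def vimage_def)
    also have "\<dots> = measure_pmf.prob (map_pmf (\<lambda>f. f {i, j}) p) {(i, j)}"
      by simp
    also have "\<dots> = measure_pmf.prob (M {i, j}) {(i, j)}"
      unfolding p_def by (subst Pi_pmf_component) (use I in auto)
    also have "\<dots> = logistic (r $ i - r $ j)"
    proof -
      consider "e {i, j} = (i, j)" | "e {i, j} = (j, i)"
        using orient[OF \<open>i \<noteq> j\<close>] by blast
      then show ?thesis
      proof cases
        case 1
        have "(\<lambda>w. if w then (i, j) else (j, i)) -` {(i, j)} = {True}"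
          using that by (auto split: if_splits)
        then show ?thesis
          unfolding M_def 1 measure_pmf_single pmf_map swap_simp fst_conv snd_conv
          by (simp add: measure_pmf_single logistic_nonneg logistic_le_1)
      next
        case 2
        have "(\<lambda>w. if w then (j, i) else (i, j)) -` {(i, j)} = {False}"
          using that by (auto split: if_splits)
        then show ?thesis
          using logistic_minus[of "r $ j - r $ i"]
          unfolding M_def 2 measure_pmf_single pmf_map swap_simp fst_conv snd_conv
          by (simp add: measure_pmf_single logistic_nonneg logistic_le_1)
      qed
    qed
    finally show ?thesis .
  qed
  ultimately show ?thesis
    unfolding bradley_terry_def by blast
qed

lemma bradley_terry_mean_scores_eq:
  "bradley_terry_mean_scores =
     {(\<chi> i. \<Sum>j\<in>UNIV - {i}. logistic (r $ i - r $ j)) | r :: real ^ 'n. True}"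
proof -
  have "mean_score \<mu> = (\<chi> i. \<Sum>j\<in>UNIV - {i}. logistic (r $ i - r $ j))"
    if "bradley_terry r \<mu>" for r :: "real ^ 'n" and \<mu>
    using that by (auto simp: bradley_terry_def vec_eq_iff mean_score_nth intro!: sum.cong)
  then have "bradley_terry r \<mu> \<Longrightarrow> \<exists>r. mean_score \<mu> = (\<chi> i. \<Sum>j\<in>UNIV - {i}. logistic (r $ i - r $ j))"
    and "\<exists>\<mu>. (\<chi> i. \<Sum>j\<in>UNIV - {i}. logistic (r $ i - r $ j)) = mean_score \<mu> \<and> bradley_terry r \<mu>"
    for r :: "real ^ 'n" and \<mu>
    using bradley_terry_exists[of r] by force+
  then show ?thesis
    unfolding bradley_terry_mean_scores_def by blast
qed

end

theory Submission
  imports Defs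
begin

text \<open>
  Let \<open>x\<close> be the mean score of a random tournament in which \<open>i\<close> beats \<open>j\<close> with probability
  \<open>P i j\<close>, and write \<open>s r\<close> for the Bradley--Terry score with parameters \<open>r\<close>. The potential
  \<open>\<Sum>i j. ln (1 + exp (r i - r j)) - P i j * (r i - r j)\<close> is nonnegative and its gradient is
  \<open>2 * (s r - x)\<close>. After adding the regularization \<open>\<epsilon> * (norm r)\<^sup>2\<close> it attains a minimum,
  at which \<open>s r - x = - \<epsilon> * r\<close>. Comparison with the value at 0 bounds \<open>\<epsilon> * (norm r)\<^sup>2\<close>
  independently of \<open>\<epsilon>\<close>, so \<open>s r\<close> tends to \<open>x\<close> as \<open>\<epsilon>\<close> tends to 0. Conversely, the mean
  scores form the convex hull of finitely many points and hence a closed set.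
\<close>

text \<open>The expectation is a convex combination of score vectors with weights
  \<open>pmf \<mu> T\<close>. Conversely, point masses realize the generating points, and tossing a
  biased coin between two random tournaments realizes the segment between their means.\<close>

lemma mean_scores_eq_convex_hull:
  "mean_scores = convex hull ((\<lambda>T. \<chi> i. real (wins T i)) ` {T :: ('n :: finite \<times> 'n) set. tournament T})"
    (is "_ = convex hull (?s ` ?A)")
proof
  show "mean_scores \<subseteq> convex hull (?s ` ?A)"
  proof
    fix x :: "real ^ 'n" assume "x \<in> mean_scores"
    then obtain \<mu> where \<mu>: "random_tournament \<mu>" and x: "x = mean_score \<mu>"
      by (auto simp: mean_scores_def)
    have sub: "set_pmf \<mu> \<subseteq> ?A"
      using \<mu> by (auto simp: random_tournament_def)
    have "x = (\<Sum>T\<in>?A. pmf \<mu> T *\<^sub>R ?s T)"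
      unfolding x mean_score_def vec_eq_iff
      by (simp add: integral_measure_pmf_real[OF finite_class.finite[of ?A]] sub[THEN subsetD] mult.commute
          del: mem_Collect_eq)
    also have "\<dots> \<in> convex hull (?s ` ?A)"
      by (rule convex_sum) (auto simp: sum_pmf_eq_1[OF _ sub] intro: hull_inc)
    finally show "x \<in> convex hull (?s ` ?A)" .
  qed
  show "convex hull (?s ` ?A) \<subseteq> mean_scores"
  proof (rule hull_minimal)
    show "?s ` ?A \<subseteq> mean_scores"
    proof
      fix x assume "x \<in> ?s ` ?A"
      then obtain T where "tournament T" "x = ?s T" by auto
      then have "random_tournament (return_pmf T)" "x = mean_score (return_pmf T)"
        by (auto simp: random_tournament_def mean_score_def)
      then show "x \<in> mean_scores"
        by (auto simp: mean_scores_def)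
    qed
    show "convex (mean_scores :: (real ^ 'n) set)"
    proof (rule convexI)
      fix x y :: "real ^ 'n" and u v :: real
      assume "x \<in> mean_scores" "y \<in> mean_scores" and uv: "0 \<le> u" "0 \<le> v" "u + v = 1"
      then obtain \<mu> \<nu> where \<mu>\<nu>: "random_tournament \<mu>" "random_tournament \<nu>"
        and xy: "x = mean_score \<mu>" "y = mean_score \<nu>"
        by (auto simp: mean_scores_def)
      define \<kappa> where "\<kappa> = bernoulli_pmf u \<bind> (\<lambda>b. if b then \<mu> else \<nu>)"
      have "random_tournament \<kappa>"
        using \<mu>\<nu> by (auto simp: random_tournament_def \<kappa>_def split: if_splits)
      moreover have "u *\<^sub>R x + v *\<^sub>R y = mean_score \<kappa>"
      proof -
        have "pmf \<kappa> T = u * pmf \<mu> T + v * pmf \<nu> T" for T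
          using uv by (simp add: \<kappa>_def pmf_bind eq_diff_eq add.commute)
        then show ?thesis
          by (simp add: xy mean_score_def vec_eq_iff integral_measure_pmf_real[OF finite_class.finite[of UNIV]]
              sum_distrib_left sum.distrib algebra_simps)
      qed
      ultimately show "u *\<^sub>R x + v *\<^sub>R y \<in> mean_scores"
        by (auto simp: mean_scores_def)
    qed
  qed
qed

lemma closed_mean_scores: "closed (mean_scores :: (real ^ 'n :: finite) set)"
  unfolding mean_scores_eq_convex_hull
  by (intro compact_imp_closed finite_imp_compact_convex_hull) simp

text \<open>The two events are complementary only on the support of \<mu>, where asymmetry and
  totality hold, so the argument goes through almost sure equality.\<close>

lemma random_tournament_prob_swap:
  assumes "random_tournament \<mu>" and "i \<noteq> j"
  shows "measure_pmf.prob \<mu> {T. (i, j) \<in> T} + measure_pmf.prob \<mu> {T. (j, i) \<in> T} = 1"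
proof -
  have "(j, i) \<in> T \<longleftrightarrow> (i, j) \<notin> T" if "T \<in> set_pmf \<mu>" for T
    using assms that by (auto simp: random_tournament_def tournament_def total_on_def dest: asymD)
  then have "measure_pmf.prob \<mu> {T. (j, i) \<in> T} = measure_pmf.prob \<mu> (- {T. (i, j) \<in> T})"
    by (intro measure_pmf.finite_measure_eq_AE) (auto simp: AE_measure_pmf_iff)
  then show ?thesis
    using measure_pmf.prob_compl[of "{T. (i, j) \<in> T}" \<mu>] by (simp add: Compl_eq_Diff_UNIV)
qed

text \<open>As a weighted mean of 0 and u, \<open>p * u\<close> is at most \<open>max 0 u\<close>,
  and the softplus function dominates that maximum. This makes every summand of the potential
  nonnegative.\<close>

lemma mult_le_ln_one_plus_exp:
  fixes p u :: real
  assumes "0 \<le> p" "p \<le> 1"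
  shows "p * u \<le> ln (1 + exp u)"
proof -
  have "p * u \<le> max 0 u"
    using assms by (cases "u \<ge> 0") (auto simp: max_def mult_left_le_one_le mult_nonneg_nonpos)
  also have "\<dots> = max (ln 1) (ln (exp u))"
    by simp
  also have "\<dots> \<le> ln (1 + exp u)"
    by (intro max.boundedI; subst ln_le_cancel_iff) (auto intro: add_pos_pos)
  finally show ?thesis .
qed

lemma regularized_minimum_exists:
  fixes f :: "'a :: euclidean_space \<Rightarrow> real"
  assumes cont: "continuous_on UNIV f" and nonneg: "\<And>r. 0 \<le> f r" and "0 < \<epsilon>"
  obtains r where "\<And>s. f r + \<epsilon> * (norm r)\<^sup>2 \<le> f s + \<epsilon> * (norm s)\<^sup>2"
proof -
  define g where "g r = f r + \<epsilon> * (norm r)\<^sup>2" for r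
  \<comment> \<open>At this radius the penalty alone equals the value at 0. No point outside the
    ball can then beat 0, so a minimum over the compact ball is global.\<close>
  define R where "R = sqrt (f 0 / \<epsilon>)"
  have R: "0 \<le> R" "\<epsilon> * R\<^sup>2 = f 0"
    using \<open>0 < \<epsilon>\<close> nonneg[of 0] by (auto simp: R_def)
  have "continuous_on (cball 0 R) g"
    unfolding g_def by (intro continuous_intros continuous_on_subset[OF cont]) auto
  then obtain r where r: "r \<in> cball 0 R" "\<And>s. s \<in> cball 0 R \<Longrightarrow> g r \<le> g s"
    using continuous_attains_inf[of "cball 0 R" g] R by force
  have "g r \<le> g s" for s
  proof (cases "s \<in> cball 0 R")
    case False
    then have "R\<^sup>2 \<le> (norm s)\<^sup>2"
      using R by (intro power_mono) auto
    then have "\<epsilon> * R\<^sup>2 \<le> \<epsilon> * (norm s)\<^sup>2"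
      using \<open>0 < \<epsilon>\<close> by simp
    then have "g 0 \<le> g s"
      using R nonneg[of s] by (simp add: g_def)
    then show ?thesis
      using r(2)[of 0] R by simp
  qed (use r in auto)
  then show ?thesis
    by (intro that) (simp add: g_def)
qed

text \<open>If \<open>P i j + P j i = 1\<close> off the diagonal, this is, up to a constant, twice
  the negative expected log-likelihood of the Bradley--Terry model: both orders of a match give the
  same summand, and each diagonal summand is \<open>ln 2\<close>.\<close>

definition bt_potential :: "('n \<Rightarrow> 'n \<Rightarrow> real) \<Rightarrow> real ^ 'n \<Rightarrow> real" where
  "bt_potential P r = (\<Sum>i\<in>UNIV. \<Sum>j\<in>UNIV. ln (1 + exp (r $ i - r $ j)) - P i j * (r $ i - r $ j))"

lemma bt_potential_nonneg:
  assumes "\<And>i j. 0 \<le> P i j" "\<And>i j. P i j \<le> 1"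
  shows "0 \<le> bt_potential P r"
  unfolding bt_potential_def by (intro sum_nonneg) (simp add: mult_le_ln_one_plus_exp assms)

lemma continuous_on_bt_potential: "continuous_on UNIV (bt_potential P)"
proof -
  have "1 + exp u \<noteq> 0" for u :: real
    using exp_gt_zero[of u] by linarith
  then show ?thesis
    unfolding bt_potential_def by (intro continuous_intros) auto
qed

lemma has_real_derivative_bt_potential:
  fixes r :: "real ^ 'n :: finite"
  assumes P: "\<And>i j. i \<noteq> j \<Longrightarrow> P i j + P j i = 1"
  shows "((\<lambda>t. bt_potential P (r + t *\<^sub>R axis k 1)) has_real_derivative
            2 * (\<Sum>j\<in>UNIV - {k}. logistic (r $ k - r $ j) - P k j)) (at 0)"
proof -
  define a where "a i j = logistic (r $ i - r $ j) - P i j" for i j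
  \<comment> \<open>The velocity of coordinate i along the line in direction k; by the chain rule
    the pair (i, j) contributes \<open>a i j * (d i - d j)\<close>.\<close>
  define d where "d i = (if i = k then 1 else 0 :: real)" for i
  have a: "a j k = - a k j" if "j \<noteq> k" for j
    using P[OF that] logistic_minus[of "r $ k - r $ j"] by (simp add: a_def)
  have nth: "(r + t *\<^sub>R axis k 1) $ i = r $ i + t * d i" for t i
    by (simp add: axis_def d_def)
  have "((\<lambda>t. bt_potential P (r + t *\<^sub>R axis k 1)) has_real_derivative
            (\<Sum>i\<in>UNIV. \<Sum>j\<in>UNIV. a i j * (d i - d j))) (at 0)"
    unfolding bt_potential_def nth a_def
    by (auto intro!: derivative_eq_intros simp: add_pos_pos logistic_def algebra_simps diff_divide_distrib)
  also have "(\<Sum>i\<in>UNIV. \<Sum>j\<in>UNIV. a i j * (d i - d j)) =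
      (\<Sum>i\<in>UNIV. \<Sum>j\<in>UNIV. a i j * d i) - (\<Sum>j\<in>UNIV. \<Sum>i\<in>UNIV. a i j * d j)"
    by (subst (3) sum.swap) (simp add: right_diff_distrib sum_subtractf)
  also have "\<dots> = (\<Sum>j\<in>UNIV. a k j - a j k)"
    unfolding sum_distrib_right[symmetric] by (simp add: d_def sum_subtractf if_distrib cong: if_cong)
  \<comment> \<open>The diagonal term cancels, leaving only pairs for which antisymmetry of
    \<open>a\<close> is known; that antisymmetry then produces the factor 2.\<close>
  also have "\<dots> = (\<Sum>j\<in>UNIV - {k}. a k j - a j k)"
    by (rule sum.mono_neutral_right) auto
  also have "\<dots> = 2 * (\<Sum>j\<in>UNIV - {k}. a k j)"
    unfolding sum_distrib_left by (rule sum.cong) (auto simp: a)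
  finally show ?thesis
    by (simp add: a_def)
qed

lemma mean_score_in_closure_bradley_terry:
  fixes \<mu> :: "('n :: finite \<times> 'n) set pmf"
  assumes "random_tournament \<mu>"
  shows "mean_score \<mu> \<in> closure bradley_terry_mean_scores"
  unfolding closure_approachable
proof (intro allI impI)
  fix \<delta> :: real assume "0 < \<delta>"
  define P where "P i j = measure_pmf.prob \<mu> {T. (i, j) \<in> T}" for i j
  define C where "C = bt_potential P 0"
  have nonneg: "0 \<le> bt_potential P r" for r
    by (rule bt_potential_nonneg) (auto simp: P_def)
  \<comment> \<open>The summand 1 keeps the denominator positive given only
    \<open>0 \<le> C\<close>, and makes \<open>\<epsilon> * C < \<delta>\<^sup>2\<close>
    strict.\<close>
  define \<epsilon> where "\<epsilon> = \<delta>\<^sup>2 / (C + 1)"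
  have \<epsilon>: "0 < \<epsilon>" "\<epsilon> * C < \<delta>\<^sup>2"
    using \<open>0 < \<delta>\<close> nonneg[of 0] by (auto simp: \<epsilon>_def C_def field_simps)
  obtain r where r: "\<And>s. bt_potential P r + \<epsilon> * (norm r)\<^sup>2 \<le> bt_potential P s + \<epsilon> * (norm s)\<^sup>2"
    using regularized_minimum_exists[OF continuous_on_bt_potential nonneg \<epsilon>(1)] by blast
  define s where "s = (\<chi> i. \<Sum>j\<in>UNIV - {i}. logistic (r $ i - r $ j))"
  have "s - mean_score \<mu> = - \<epsilon> *\<^sub>R r"
  proof (rule vec_eq_iff[THEN iffD2], rule allI)
    fix k
    have norm: "(norm (r + t *\<^sub>R axis k 1))\<^sup>2 = (norm r)\<^sup>2 + 2 * t * r $ k + t * t" for t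
      unfolding power2_norm_eq_inner
      by (simp add: inner_add inner_axis inner_commute[of "axis k 1"] inner_axis_axis algebra_simps)
    have "((\<lambda>t. bt_potential P (r + t *\<^sub>R axis k 1) + \<epsilon> * (norm (r + t *\<^sub>R axis k 1))\<^sup>2)
        has_real_derivative 2 * (\<Sum>j\<in>UNIV - {k}. logistic (r $ k - r $ j) - P k j) + \<epsilon> * (2 * r $ k)) (at 0)"
      unfolding norm using random_tournament_prob_swap[OF assms]
      by (auto intro!: derivative_eq_intros has_real_derivative_bt_potential simp: P_def)
    \<comment> \<open>The minimum is global, so any neighbourhood of t = 0 serves; radius 1 is
      taken.\<close>
    from DERIV_local_min[OF this zero_less_one] r
    have "2 * (\<Sum>j\<in>UNIV - {k}. logistic (r $ k - r $ j) - P k j) + \<epsilon> * (2 * r $ k) = 0"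
      by simp
    then show "(s - mean_score \<mu>) $ k = (- \<epsilon> *\<^sub>R r) $ k"
      by (simp add: s_def mean_score_nth[OF assms] P_def sum_subtractf)
  qed
  then have "(dist s (mean_score \<mu>))\<^sup>2 = \<epsilon> * (\<epsilon> * (norm r)\<^sup>2)"
    using \<epsilon> by (simp add: dist_norm power2_eq_square)
  \<comment> \<open>Minimality against the point 0 gives
    \<open>\<epsilon> * (norm r)\<^sup>2 \<le> C\<close>, since the potential at r is
    nonnegative.\<close>
  also have "\<dots> \<le> \<epsilon> * C"
    using r[of 0] nonneg[of r] \<epsilon> by (simp add: C_def)
  also have "\<dots> < \<delta>\<^sup>2" by (rule \<epsilon>)
  finally have "dist s (mean_score \<mu>) < \<delta>"
    using \<open>0 < \<delta>\<close> by (auto intro: power2_less_imp_less)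
  moreover have "s \<in> bradley_terry_mean_scores"
    by (auto simp: bradley_terry_mean_scores_eq s_def)
  ultimately show "\<exists>y\<in>bradley_terry_mean_scores. dist y (mean_score \<mu>) < \<delta>"
    by blast
qed

theorem theorem1:
  shows "closure (bradley_terry_mean_scores :: (real ^ 'n :: finite) set) = mean_scores"
proof
  show "closure bradley_terry_mean_scores \<subseteq> (mean_scores :: (real ^ 'n) set)"
    by (rule closure_minimal[OF bradley_terry_mean_scores_subset closed_mean_scores])
  show "(mean_scores :: (real ^ 'n) set) \<subseteq> closure bradley_terry_mean_scores"
    using mean_score_in_closure_bradley_terry by (auto simp: mean_scores_def)
qed

end
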